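(* Let $N\ge 1$ and $0<\rho<\frac{\pi}{2N}$. The normalized weighted histopolation matrix $H_N\in\mathbb R^{N\times N}$ for the Chebyshev weight of the first kind on the cells of constant angular length $s_i=[\cos(\tau_i+\rho),\cos(\tau_i-\rho)]$, $\tau_i=\frac{(2i-1)\pi}{2N}$, $i=1,\ldots,N$, satisfies $$H_N^\top H_N=\operatorname{diag}(\mu_0,\mu_1,\ldots,\mu_{N-1}),$$ where $$\mu_0=N,\qquad \mu_k=\frac N2\left[a_k\frac{\sin(k\rho)}{k\rho}\right]^2,\quad k=1,\ldots,N-1,\qquad a_k=\frac{(1/2)_k}{k!}.$$ In particular, $H_N$ is nonsingular.
   Context: $(s)_k$ is the Pochhammer symbol (rising factorial). The weight is $\omega(x)=\frac{1}{\sqrt{1-x^2}}$ on $(-1,1)$. $P_k^{(-1/2,-1/2)}$ is the classical Jacobi polynomial, i.e. $P_k^{(-1/2,-1/2)}(\cos\theta)=a_k\cos(k\theta)$. With the cell masses $m_i=\int_{s_i}\omega(x)\,dx$, the matrix $H_N$ is defined by $$[H_N]_{i,k+1}=\frac1{m_i}\int_{s_i}P_k^{(-1/2,-1/2)}(x)\,\omega(x)\,dx,\quad i=1,\ldots,N,\ k=0,\ldots,N-1.$$ *)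

theory Defs
  imports "HOL-Analysis.Analysis" "Jordan_Normal_Form.Matrix"
begin

(* The classical Jacobi polynomial in the standard normalization
   P_n(1) = (\<alpha> + 1)_n / n!, by the explicit formula
   P_n(x) = sum_s C(n + \<alpha>, n - s) C(n + \<beta>, s) ((x - 1) / 2)^s ((x + 1) / 2)^(n - s),
   with generalized binomial coefficients. *)
definition jacobi_poly :: "real \<Rightarrow> real \<Rightarrow> nat \<Rightarrow> real poly" where
  "jacobi_poly \<alpha> \<beta> n =
     (\<Sum>s\<le>n. Polynomial.smult (((real n + \<alpha>) gchoose (n - s)) * ((real n + \<beta>) gchoose s))
              ([:- 1 / 2, 1 / 2:] ^ s * [:1 / 2, 1 / 2:] ^ (n - s)))"

definition chebyshev_weight :: "real \<Rightarrow> real" where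
  "chebyshev_weight x = 1 / sqrt (1 - x\<^sup>2)"

definition cell_angle :: "nat \<Rightarrow> nat \<Rightarrow> real" where
  "cell_angle N i = (2 * real i - 1) * pi / (2 * real N)"

definition cell :: "nat \<Rightarrow> real \<Rightarrow> nat \<Rightarrow> real set" where
  "cell N \<rho> i = {cos (cell_angle N i + \<rho>) .. cos (cell_angle N i - \<rho>)}"

definition cell_mass :: "nat \<Rightarrow> real \<Rightarrow> nat \<Rightarrow> real" where
  "cell_mass N \<rho> i = (LBINT x:cell N \<rho> i. chebyshev_weight x)"

(* Matrix rows and columns are indexed from 0: row i belongs to the cell
   with the 1-based number i + 1, column k to the polynomial of degree k. *)
definition histopolation_matrix :: "nat \<Rightarrow> real \<Rightarrow> real mat" where
  "histopolation_matrix N \<rho> = Matrix.mat N N (\<lambda>(i, k).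
     1 / cell_mass N \<rho> (i + 1) *
       (LBINT x:cell N \<rho> (i + 1).
          poly (jacobi_poly (- 1 / 2) (- 1 / 2) k) x * chebyshev_weight x))"

definition jacobi_cos_coeff :: "nat \<Rightarrow> real" where
  "jacobi_cos_coeff k = pochhammer (1 / 2) k / fact k"

definition gram_diag :: "nat \<Rightarrow> real \<Rightarrow> nat \<Rightarrow> real" where
  "gram_diag N \<rho> k =
     (if k = 0 then real N
      else real N / 2 * (jacobi_cos_coeff k * (sin (real k * \<rho>) / (real k * \<rho>)))\<^sup>2)"

end

theory Submission
  imports Defs "Jordan_Normal_Form.Determinant"
begin

text \<open>
  The substitution \<open>x = cos \<theta>\<close> turns the weighted integral over a cell into an ordinary
  integral over an interval of length \<open>2 * \<rho>\<close> centred at the angle \<open>\<tau>\<^sub>i\<close>, and it turns the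
  \<open>k\<close>-th polynomial into \<open>a\<^sub>k * cos (k * \<theta>)\<close>
  (\<open>weighted_integral_by_angle\<close>, \<open>jacobi_poly_half_cos\<close>).  Averaging \<open>cos (k * \<theta>)\<close> over such an
  interval only multiplies its value at the centre by the factor
  \<open>sin (k * \<rho>) / (k * \<rho>)\<close>, which does not depend on the cell.  Hence the matrix is the matrix of
  the values \<open>cos (k * \<tau>\<^sub>i)\<close> with its columns rescaled (\<open>histopolation_matrix_entry\<close>).

  The angles \<open>\<tau>\<^sub>i\<close> are those of the zeros of the Chebyshev polynomial of degree \<open>N\<close>, on which the
  cosines of degree below \<open>N\<close> are orthogonal (\<open>cos_cell_angle_orthogonal\<close>).  So the columns of
  the matrix are orthogonal and the Gram matrix is diagonal, with entries the squared column
  scalings times \<open>N\<close> or \<open>N / 2\<close>.  The bound on \<open>\<rho>\<close> puts \<open>k * \<rho>\<close> strictly between \<open>0\<close> and \<open>\<pi>\<close>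
  for \<open>0 < k < N\<close>, and \<open>a\<^sub>k\<close> is positive, so no diagonal entry vanishes; a square matrix with invertible Gram matrix is
  invertible.
\<close>

section \<open>The Jacobi polynomials with both parameters \<open>-1/2\<close> on the unit circle\<close>

text \<open>The real part of the binomial expansion of \<open>(cos t + \<i> * sin t) ^ (2 * n)\<close>: only the even
  powers of \<open>\<i>\<close> contribute.\<close>

lemma cos_even_multiple_expansion:
  "cos (real (2 * n) * t) =
     (\<Sum>s\<le>n. real ((2 * n) choose (2 * s)) * (-1) ^ s * sin t ^ (2 * s) * cos t ^ (2 * (n - s)))"
proof -
  let ?f = "\<lambda>j. real ((2 * n) choose j) * Re (\<i> ^ j) * sin t ^ j * cos t ^ (2 * n - j)"
  have "cis (real (2 * n) * t) = (\<i> * of_real (sin t) + of_real (cos t)) ^ (2 * n)"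
  proof -
    have "\<i> * of_real (sin t) + of_real (cos t) = cis t" by (simp add: complex_eq_iff)
    thus ?thesis by (simp only: Complex.DeMoivre)
  qed
  also have "\<dots> = (\<Sum>j\<le>2 * n. of_nat ((2 * n) choose j) * (\<i> * of_real (sin t)) ^ j
                    * of_real (cos t) ^ (2 * n - j))"
    by (rule binomial_ring)
  also have "\<dots> = (\<Sum>j\<le>2 * n. of_real (real ((2 * n) choose j) * sin t ^ j * cos t ^ (2 * n - j)) * \<i> ^ j)"
    by (intro sum.cong refl) (simp add: power_mult_distrib mult_ac)
  finally have "Re (cis (real (2 * n) * t)) =
      Re (\<Sum>j\<le>2 * n. of_real (real ((2 * n) choose j) * sin t ^ j * cos t ^ (2 * n - j)) * \<i> ^ j)"
    by simp
  moreover have "Re (of_real r * z) = r * Re z" for r z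
    by simp
  ultimately have "cos (real (2 * n) * t) = (\<Sum>j\<le>2 * n. ?f j)"
    unfolding Re_sum cis.sel by (simp add: mult_ac)
  also have "\<dots> = (\<Sum>j\<in>(\<lambda>s. 2 * s) ` {..n}. ?f j)"
  proof (rule sum.mono_neutral_right)
    show "\<forall>j\<in>{..2 * n} - (\<lambda>s. 2 * s) ` {..n}. ?f j = 0"
    proof
      fix j assume j: "j \<in> {..2 * n} - (\<lambda>s. 2 * s) ` {..n}"
      have "odd j"
      proof
        assume "even j"
        then obtain s where "j = 2 * s" by (elim evenE)
        with j show False by auto
      qed
      then obtain s where "j = Suc (2 * s)" by (auto elim: oddE)
      hence "Re (\<i> ^ j) = 0" by (cases "even s") (auto simp: power_mult)
      thus "?f j = 0" by simp
    qed
  qed auto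
  also have "\<dots> = (\<Sum>s\<le>n. ?f (2 * s))"
    by (subst sum.reindex) (auto simp: inj_on_def)
  also have "\<dots> = (\<Sum>s\<le>n. real ((2 * n) choose (2 * s)) * (-1) ^ s * sin t ^ (2 * s) * cos t ^ (2 * (n - s)))"
  proof (intro sum.cong refl)
    fix s
    have "Re (\<i> ^ (2 * s)) = (-1) ^ s" by (cases "even s") (auto simp: power_mult)
    thus "?f (2 * s) = real ((2 * n) choose (2 * s)) * (-1) ^ s * sin t ^ (2 * s) * cos t ^ (2 * (n - s))"
      by (simp add: right_diff_distrib')
  qed
  finally show ?thesis .
qed

text \<open>Since \<open>(1/2)\<^sub>n * n! = (2 * n)! / 4 ^ n\<close>, the factorials of the half-integers that occur in the two
  generalized binomial coefficients combine into factorials of integers.\<close>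

lemma half_gbinomial_product:
  assumes "s \<le> n"
  shows "((real n - 1/2) gchoose (n - s)) * ((real n - 1/2) gchoose s)
           = jacobi_cos_coeff n * real ((2 * n) choose (2 * s))"
proof -
  define p where "p j = pochhammer (1/2 :: real) j" for j
  have p_pos: "p j > 0" for j unfolding p_def by (intro pochhammer_pos) simp
  have gb: "((real n - 1/2) gchoose j) = p n / (p (n - j) * fact j)" if "j \<le> n" for j
  proof -
    have "p n = p (n - j) * pochhammer (1/2 + real (n - j)) j"
      unfolding p_def using pochhammer_product[of "n - j" n "1/2::real"] that by simp
    moreover have "(real n - 1/2) gchoose j = pochhammer (1/2 + real (n - j)) j / fact j"
      unfolding gbinomial_pochhammer' using that by (simp add: of_nat_diff algebra_simps)
    ultimately show ?thesis using p_pos[of "n - j"] by simp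
  qed
  have fd: "fact (2 * j) = 4 ^ j * p j * fact j" for j
    unfolding p_def fact_double by (simp add: power_mult)
  have pow: "(4::real) ^ n = 4 ^ s * 4 ^ (n - s)"
    using assms by (simp flip: power_add)
  have "real ((2 * n) choose (2 * s)) = fact (2 * n) / (fact (2 * s) * fact (2 * (n - s)))"
    using assms by (subst binomial_fact) (auto simp: right_diff_distrib')
  also have "\<dots> = p n * fact n / (p s * fact s * (p (n - s) * fact (n - s)))"
    unfolding fd pow by (simp add: field_simps)
  finally show ?thesis
    using gb[of s] gb[of "n - s"] assms p_pos[of s] p_pos[of "n - s"] p_pos[of n]
    by (simp add: jacobi_cos_coeff_def flip: p_def)
qed

text \<open>With the half angle \<open>t = \<theta> / 2\<close> the two linear factors \<open>(x - 1) / 2\<close> and \<open>(x + 1) / 2\<close> of the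
  explicit formula are \<open>- (sin t)\<^sup>2\<close> and \<open>(cos t)\<^sup>2\<close>, so the formula becomes the expansion of
  \<open>cos (2 * k * t)\<close>.\<close>

lemma jacobi_poly_half_cos:
  "poly (jacobi_poly (- 1 / 2) (- 1 / 2) k) (cos \<theta>) = jacobi_cos_coeff k * cos (real k * \<theta>)"
proof -
  define t where "t = \<theta> / 2"
  have \<theta>: "\<theta> = 2 * t" by (simp add: t_def)
  have m: "poly [:- 1 / 2, 1 / 2:] (cos \<theta>) = - ((sin t)\<^sup>2)"
    unfolding \<theta> cos_double_sin by (simp add: field_simps)
  have p: "poly [:1 / 2, 1 / 2:] (cos \<theta>) = (cos t)\<^sup>2"
    unfolding \<theta> cos_double_cos by (simp add: field_simps)
  have "poly (jacobi_poly (- 1 / 2) (- 1 / 2) k) (cos \<theta>) =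
      (\<Sum>s\<le>k. ((real k - 1/2) gchoose (k - s)) * ((real k - 1/2) gchoose s)
         * ((- ((sin t)\<^sup>2)) ^ s * ((cos t)\<^sup>2) ^ (k - s)))"
    unfolding jacobi_poly_def poly_sum poly_smult poly_mult poly_power m p by simp
  also have "\<dots> = (\<Sum>s\<le>k. jacobi_cos_coeff k *
      (real ((2 * k) choose (2 * s)) * (-1) ^ s * sin t ^ (2 * s) * cos t ^ (2 * (k - s))))"
  proof (intro sum.cong refl)
    fix s assume "s \<in> {..k}"
    hence "s \<le> k" by simp
    have "(- ((sin t)\<^sup>2)) ^ s = (-1) ^ s * sin t ^ (2 * s)"
      by (subst power_minus) (simp only: power_mult)
    moreover have "((cos t)\<^sup>2) ^ (k - s) = cos t ^ (2 * (k - s))" by (simp only: power_mult)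
    ultimately show "((real k - 1/2) gchoose (k - s)) * ((real k - 1/2) gchoose s)
         * ((- ((sin t)\<^sup>2)) ^ s * ((cos t)\<^sup>2) ^ (k - s)) = jacobi_cos_coeff k *
      (real ((2 * k) choose (2 * s)) * (-1) ^ s * sin t ^ (2 * s) * cos t ^ (2 * (k - s)))"
      unfolding half_gbinomial_product[OF \<open>s \<le> k\<close>] by (simp only: mult_ac)
  qed
  also have "\<dots> = jacobi_cos_coeff k * cos (real (2 * k) * t)"
    unfolding cos_even_multiple_expansion sum_distrib_left ..
  finally show ?thesis by (simp add: \<theta> mult_ac)
qed

section \<open>The entries of the histopolation matrix\<close>

text \<open>The substitution \<open>x = cos \<theta>\<close> in terms of antiderivatives: the weight is the absolute value
  of the derivative of \<open>arccos\<close>, so \<open>- G (arccos x)\<close> is an antiderivative of the integrand.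
  Keeping \<open>a\<close> and \<open>b\<close> away from \<open>0\<close> and \<open>\<pi>\<close> makes the integrand continuous.\<close>

lemma weighted_integral_by_angle:
  assumes ab: "0 < a" "a \<le> b" "b < pi"
    and f: "continuous_on {cos b..cos a} f"
    and G: "\<And>t. a \<le> t \<Longrightarrow> t \<le> b \<Longrightarrow> (G has_real_derivative f (cos t)) (at t)"
  shows "(LBINT x:{cos b..cos a}. f x * chebyshev_weight x) = G b - G a"
proof -
  let ?F = "\<lambda>x. - G (arccos x)"
  have less: "cos a < 1" "- 1 < cos b"
    using cos_monotone_0_pi[of 0 a] cos_monotone_0_pi[of b pi] ab by auto
  have sq: "1 - x\<^sup>2 > 0" if "x \<in> {cos b..cos a}" for x
    using that less by (simp add: abs_square_less_1 abs_less_iff)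
  have deriv: "(?F has_real_derivative f x * chebyshev_weight x) (at x)"
    if x: "cos b \<le> x" "x \<le> cos a" for x
  proof -
    have x1: "-1 < x" "x < 1" using x less by auto
    have "arccos x \<le> arccos (cos b)" using x x1 ab by (intro arccos_le_arccos) auto
    moreover have "arccos (cos a) \<le> arccos x" using x x1 ab by (intro arccos_le_arccos) auto
    ultimately have "a \<le> arccos x" "arccos x \<le> b" using ab by (auto simp: arccos_cos)
    hence "(G has_real_derivative f x) (at (arccos x))"
      using G[of "arccos x"] x1 by simp
    from DERIV_minus[OF DERIV_chain2[OF this DERIV_arccos[OF x1]]]
    show ?thesis by (simp add: chebyshev_weight_def field_simps)
  qed
  have "(LBINT x:{cos b..cos a}. f x * chebyshev_weight x) = ?F (cos a) - ?F (cos b)"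
    unfolding set_lebesgue_integral_def
  proof (rule integral_FTC_atLeastAtMost)
    show "cos b \<le> cos a" using ab by (intro cos_monotone_0_pi_le) auto
    show "(?F has_vector_derivative f x * chebyshev_weight x) (at x within {cos b..cos a})"
      if "cos b \<le> x" "x \<le> cos a" for x
      using deriv[OF that] has_field_derivative_at_within has_real_derivative_iff_has_vector_derivative
      by blast
    have "sqrt (1 - x\<^sup>2) \<noteq> 0" if "x \<in> {cos b..cos a}" for x
      using sq[OF that] by simp
    thus "continuous_on {cos b..cos a} (\<lambda>x. f x * chebyshev_weight x)"
      unfolding chebyshev_weight_def by (intro continuous_intros f) auto
  qed
  thus ?thesis using ab by (simp add: arccos_cos)
qed

text \<open>The cells stay away from \<open>1\<close> and \<open>-1\<close>, where the weight has its singularities.\<close>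

lemma cell_angle_bounds:
  assumes "i < N" "\<rho> < pi / (2 * real N)"
  shows "0 < cell_angle N (i + 1) - \<rho>" "cell_angle N (i + 1) + \<rho> < pi"
proof -
  have eq: "cell_angle N (i + 1) = (2 * real i + 1) * (pi / (2 * real N))"
    by (simp add: cell_angle_def)
  have "pi / (2 * real N) * 1 \<le> pi / (2 * real N) * (2 * real i + 1)"
    by (intro mult_left_mono) auto
  thus "0 < cell_angle N (i + 1) - \<rho>" using assms unfolding eq by (simp add: mult.commute)
  have "(2 * real i + 1 + 1) * (pi / (2 * real N)) \<le> (2 * real N) * (pi / (2 * real N))"
    using assms by (intro mult_right_mono) auto
  also have "\<dots> = pi" using assms by simp
  finally show "cell_angle N (i + 1) + \<rho> < pi" using assms unfolding eq
    by (simp only: distrib_right mult_1_left)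
qed

text \<open>The cell average of the \<open>k\<close>-th polynomial, relative to the value of \<open>cos (k * \<theta>)\<close> at the centre
  of the cell.  The value at \<open>k = 0\<close> is the limit of the other formula, where \<open>a\<^sub>0 = 1\<close>.\<close>

definition column_scale :: "real \<Rightarrow> nat \<Rightarrow> real" where
  "column_scale \<rho> k =
     (if k = 0 then 1 else jacobi_cos_coeff k * (sin (real k * \<rho>) / (real k * \<rho>)))"

lemma histopolation_matrix_entry:
  assumes i: "i < N" and k: "k < N" and \<rho>: "0 < \<rho>" "\<rho> < pi / (2 * real N)"
  shows "histopolation_matrix N \<rho> $$ (i, k) =
           column_scale \<rho> k * cos (real k * cell_angle N (i + 1))"
proof -
  let ?\<tau> = "cell_angle N (i + 1)"
  define P where "P = jacobi_poly (- 1 / 2) (- 1 / 2) k"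
  have P: "poly P (cos t) = jacobi_cos_coeff k * cos (real k * t)" for t
    unfolding P_def by (rule jacobi_poly_half_cos)
  have cell: "cell N \<rho> (i + 1) = {cos (?\<tau> + \<rho>)..cos (?\<tau> - \<rho>)}" by (simp add: cell_def)
  note b = cell_angle_bounds[OF i \<rho>(2)]
  note integral = weighted_integral_by_angle[OF b(1) _ b(2)]
  have mass: "cell_mass N \<rho> (i + 1) = 2 * \<rho>"
    using integral[of "\<lambda>_. 1" "\<lambda>t. t"] \<rho> unfolding cell_mass_def cell by simp
  have "(LBINT x:cell N \<rho> (i + 1). poly P x * chebyshev_weight x) =
          2 * \<rho> * (column_scale \<rho> k * cos (real k * ?\<tau>))"
  proof (cases "k = 0")
    case True
    have "(LBINT x:cell N \<rho> (i + 1). poly P x * chebyshev_weight x) = (?\<tau> + \<rho>) - (?\<tau> - \<rho>)"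
      unfolding cell using \<rho>
      by (intro integral)
         (auto intro!: continuous_intros simp: P True jacobi_cos_coeff_def)
    thus ?thesis by (simp add: True column_scale_def)
  next
    case False
    have "(LBINT x:cell N \<rho> (i + 1). poly P x * chebyshev_weight x) =
        jacobi_cos_coeff k * sin (real k * (?\<tau> + \<rho>)) / real k
          - jacobi_cos_coeff k * sin (real k * (?\<tau> - \<rho>)) / real k"
      unfolding cell using \<rho> False
      by (intro integral)
         (auto intro!: continuous_intros derivative_eq_intros simp: P)
    also have "\<dots> = 2 * \<rho> * (column_scale \<rho> k * cos (real k * ?\<tau>))"
      using False \<rho> by (simp add: column_scale_def distrib_left right_diff_distrib sin_add sin_diff field_simps)
    finally show ?thesis .
  qed
  thus ?thesis using i k \<rho> mass by (simp add: histopolation_matrix_def P_def)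
qed

section \<open>Discrete orthogonality of the cosines\<close>

text \<open>Multiplication by \<open>2 * sin (m * \<pi> / (2 * N))\<close>, which is nonzero in this range of \<open>m\<close>, makes the sum
  telescope, because consecutive angles differ by \<open>\<pi> / N\<close>.\<close>

lemma sum_cos_cell_angle:
  assumes m: "0 < m" "m < 2 * N"
  shows "(\<Sum>i<N. cos (real m * cell_angle N (i + 1))) = 0"
proof -
  have N: "N > 0" using m by simp
  define h where "h = real m * pi / (2 * real N)"
  have "h < pi" using m N by (simp add: h_def field_simps flip: of_nat_mult)
  moreover have "h > 0" using m N by (simp add: h_def)
  ultimately have h: "sin h > 0" by (intro sin_gt_zero)
  have "2 * sin h * (\<Sum>i<N. cos (real m * cell_angle N (i + 1))) =
      (\<Sum>i<N. sin (2 * h * real (Suc i)) - sin (2 * h * real i))"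
    unfolding sum_distrib_left
  proof (intro sum.cong refl)
    fix i
    have "real m * cell_angle N (i + 1) = 2 * h * real i + h"
      using N by (simp add: cell_angle_def h_def field_simps)
    moreover have "2 * sin h * cos (2 * h * real i + h) =
        sin ((2 * h * real i + h) + h) - sin ((2 * h * real i + h) - h)"
      by (subst sin_add, subst sin_diff) simp
    moreover have "(2 * h * real i + h) + h = 2 * h * real (Suc i)" by (simp add: algebra_simps)
    ultimately show "2 * sin h * cos (real m * cell_angle N (i + 1)) =
        sin (2 * h * real (Suc i)) - sin (2 * h * real i)"
      by simp
  qed
  also have "\<dots> = sin (2 * h * real N)" by (subst sum_lessThan_telescope) simp
  also have "2 * h * real N = real m * pi" using N by (simp add: h_def)
  finally show ?thesis using h by simp
qed

lemma cos_cell_angle_orthogonal: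
  assumes j: "j < N" and k: "k < N"
  shows "(\<Sum>i<N. cos (real j * cell_angle N (i + 1)) * cos (real k * cell_angle N (i + 1))) =
           (if j \<noteq> k then 0 else if k = 0 then real N else real N / 2)"
proof -
  let ?\<tau> = "\<lambda>i. cell_angle N (i + 1)"
  \<comment> \<open>\<open>max j k - min j k\<close> is the distance \<open>\<bar>j - k\<bar>\<close> as a natural number, so that the preceding
    lemma applies to both sums.\<close>
  have product_to_sum: "(\<Sum>i<N. cos (real j * ?\<tau> i) * cos (real k * ?\<tau> i)) =
      ((\<Sum>i<N. cos (real (j + k) * ?\<tau> i)) + (\<Sum>i<N. cos (real (max j k - min j k) * ?\<tau> i))) / 2"
  proof -
    have "cos (real j * t) * cos (real k * t) =
        (cos (real (j + k) * t) + cos (real (max j k - min j k) * t)) / 2" for t :: real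
      by (cases "j \<le> k")
         (simp_all add: of_nat_diff distrib_right left_diff_distrib cos_add cos_diff)
    thus ?thesis by (simp only: sum.distrib flip: sum_divide_distrib)
  qed
  show ?thesis
  proof (cases "j = k")
    case False
    have "(\<Sum>i<N. cos (real (j + k) * ?\<tau> i)) = 0"
      using False j k by (intro sum_cos_cell_angle) auto
    moreover have "(\<Sum>i<N. cos (real (max j k - min j k) * ?\<tau> i)) = 0"
      using False j k by (intro sum_cos_cell_angle) auto
    ultimately show ?thesis using False unfolding product_to_sum by simp
  next
    case True
    show ?thesis
    proof (cases "k = 0")
      case False
      hence "(\<Sum>i<N. cos (real (k + k) * ?\<tau> i)) = 0"
        using k by (intro sum_cos_cell_angle) auto
      thus ?thesis using True False unfolding product_to_sum by simp
    qed (simp add: True)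
  qed
qed

section \<open>The Gram matrix and invertibility\<close>

lemma gram_diag_nonzero:
  assumes k: "k < N" and \<rho>: "0 < \<rho>" "\<rho> < pi / (2 * real N)"
  shows "gram_diag N \<rho> k \<noteq> 0"
proof (cases "k = 0")
  case False
  have "real k * \<rho> < real N * (pi / (2 * real N))"
    using k \<rho> by (intro mult_strict_mono) auto
  also have "\<dots> < pi" using k by simp
  finally have "sin (real k * \<rho>) > 0" using False \<rho> by (intro sin_gt_zero) auto
  moreover have "jacobi_cos_coeff k > 0"
    unfolding jacobi_cos_coeff_def by (intro divide_pos_pos pochhammer_pos) auto
  ultimately show ?thesis using False k \<rho> by (simp add: gram_diag_def)
qed (use k in \<open>simp add: gram_diag_def\<close>)

lemma invertible_mat_of_diagonal_gram:
  fixes A :: "'a :: field mat"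
  assumes A: "A \<in> carrier_mat n n" and gram: "transpose_mat A * A = mat_diag n d"
    and d: "\<And>i. i < n \<Longrightarrow> d i \<noteq> 0"
  shows "invertible_mat A"
proof -
  define B where "B = mat_diag n (\<lambda>i. inverse (d i)) * transpose_mat A"
  have B: "B \<in> carrier_mat n n"
    unfolding B_def using A by (intro mult_carrier_mat[of _ n n]) auto
  have "B * A = mat_diag n (\<lambda>i. inverse (d i)) * mat_diag n d"
    unfolding B_def using A by (subst assoc_mult_mat[of _ n n _ n _ n]) (auto simp: gram)
  also have "\<dots> = 1\<^sub>m n"
    using d by (subst mat_diag_diag) (auto simp: mat_diag_def intro!: eq_matI)
  finally have BA: "B * A = 1\<^sub>m n" .
  have "A * B = 1\<^sub>m n" by (rule mat_mult_left_right_inverse[OF B A BA])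
  thus ?thesis using A B BA unfolding invertible_mat_def inverts_mat_def by auto
qed

theorem theorem3:
  fixes N :: nat and \<rho> :: real
  assumes "N \<ge> 1" and "0 < \<rho>" and "\<rho> < pi / (2 * real N)"
  shows "transpose_mat (histopolation_matrix N \<rho>) * histopolation_matrix N \<rho>
           = mat_diag N (gram_diag N \<rho>)
         \<and> invertible_mat (histopolation_matrix N \<rho>)"
proof -
  let ?H = "histopolation_matrix N \<rho>"
  have H: "?H \<in> carrier_mat N N" by (simp add: histopolation_matrix_def)
  have gram: "transpose_mat ?H * ?H = mat_diag N (gram_diag N \<rho>)"
  proof (rule eq_matI)
    fix j k assume "j < dim_row (mat_diag N (gram_diag N \<rho>))" "k < dim_col (mat_diag N (gram_diag N \<rho>))"
    hence jk: "j < N" "k < N" by (auto simp: mat_diag_def)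
    have "(transpose_mat ?H * ?H) $$ (j, k) = (\<Sum>i<N. ?H $$ (i, j) * ?H $$ (i, k))"
      using H jk by (simp add: scalar_prod_def atLeast0LessThan)
    also have "\<dots> = (\<Sum>i<N. column_scale \<rho> j * column_scale \<rho> k *
        (cos (real j * cell_angle N (i + 1)) * cos (real k * cell_angle N (i + 1))))"
      using jk assms by (intro sum.cong refl) (simp add: histopolation_matrix_entry)
    also have "\<dots> = column_scale \<rho> j * column_scale \<rho> k *
        (if j \<noteq> k then 0 else if k = 0 then real N else real N / 2)"
      using jk by (simp only: cos_cell_angle_orthogonal flip: sum_distrib_left)
    also have "\<dots> = mat_diag N (gram_diag N \<rho>) $$ (j, k)"
      using jk by (simp add: mat_diag_def gram_diag_def column_scale_def power2_eq_square mult_ac)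
    finally show "(transpose_mat ?H * ?H) $$ (j, k) = mat_diag N (gram_diag N \<rho>) $$ (j, k)" .
  qed (use H in \<open>auto simp: mat_diag_def\<close>)
  moreover have "invertible_mat ?H"
    using gram_diag_nonzero assms by (intro invertible_mat_of_diagonal_gram[OF H gram])
  ultimately show ?thesis by simp
qed

end
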